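(* Let $G$ be a unicyclic graph. For every integer $\ell\ge 3$, \[ Z_{(\ell)}(G)=\bigl|\{v\in V(G):\deg(v)\le \ell\}\bigr|. \]
   Context: All graphs are finite, simple and undirected. Let $G$ be a graph, $S\subseteq V(G)$ a set of initially blue vertices (all other vertices white), and $L\subseteq V(G)$ a set of leaks. The leaky color change rule: a blue vertex $b\notin L$ which has exactly one white neighbor $w$ may force $w$ to become blue. $S$ is an $\ell$-leaky forcing set if for every choice of a set $L$ of $\ell$ leaks, repeated application of the rule eventually turns all vertices blue (if $\ell>|V(G)|$, this is read with $L=V(G)$). $Z_{(\ell)}(G)$ is the minimum size of an $\ell$-leaky forcing set of $G$. A unicyclic graph is a connected graph containing exactly one cycle. *)

theory Defs
  imports "Graph_Theory.Digraph_Component"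
begin

text \<open>
  A finite simple undirected graph is an instance of the locale \<^locale>\<open>graph\<close>: a finite
  symmetric digraph without loops and parallel arcs, an undirected edge being a pair of
  opposite arcs. Hence the degree of a vertex is its \<^const>\<open>out_degree\<close>.
\<close>

text \<open>
  The library predicate \<^const>\<open>pre_digraph.cycle\<close> also admits the closed walk along an edge and
  back, so the length bound 3 is what singles out the cycles of a simple undirected graph.
  A cycle is represented by its set of undirected edges, so that closed walks differing only
  in starting point or orientation count as the same cycle.
\<close>
definition cycles :: "('a,'b) pre_digraph \<Rightarrow> 'a set set set" where
  "cycles G = {(\<lambda>e. {tail G e, head G e}) ` set p | p. pre_digraph.cycle G p \<and> 3 \<le> length p}"

definition unicyclic :: "('a,'b) pre_digraph \<Rightarrow> bool" where
  "unicyclic G \<longleftrightarrow> connected G \<and> (\<exists>!C. C \<in> cycles G)"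

text \<open>
  One application of the leaky colour change rule with leaks \<open>L\<close>, taking the set \<open>B\<close> of blue
  vertices to \<open>B'\<close>.
\<close>
definition leaky_force :: "('a,'b) pre_digraph \<Rightarrow> 'a set \<Rightarrow> 'a set \<Rightarrow> 'a set \<Rightarrow> bool" where
  "leaky_force G L B B' \<longleftrightarrow>
     (\<exists>b w. b \<in> B \<and> b \<notin> L \<and> {u. b \<rightarrow>\<^bsub>G\<^esub> u \<and> u \<notin> B} = {w} \<and> B' = insert w B)"

text \<open>
  The minimum implements the convention that all vertices are leaks if \<open>l\<close> exceeds the number
  of vertices.
\<close>
definition leaky_forcing_set :: "nat \<Rightarrow> ('a,'b) pre_digraph \<Rightarrow> 'a set \<Rightarrow> bool" where
  "leaky_forcing_set l G S \<longleftrightarrow>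
     S \<subseteq> verts G \<and>
     (\<forall>L. L \<subseteq> verts G \<and> card L = min l (card (verts G)) \<longrightarrow> (leaky_force G L)\<^sup>*\<^sup>* S (verts G))"

definition leaky_forcing_number :: "nat \<Rightarrow> ('a,'b) pre_digraph \<Rightarrow> nat" where
  "leaky_forcing_number l G = (LEAST k. \<exists>S. leaky_forcing_set l G S \<and> card S = k)"

end

theory Submission
  imports Defs
begin

text \<open>
  Let \<open>S\<close> be the set of vertices of degree at most \<open>l\<close>. Every leaky forcing set contains \<open>S\<close>,
  because placing leaks on all neighbours of a vertex \<open>v \<in> S\<close> keeps \<open>v\<close> from ever being forced
  (\<open>low_degree_subset_leaky_forcing_set\<close>).

  Conversely \<open>S\<close> itself is a leaky forcing set, by double counting. Suppose that, starting from
  \<open>S\<close>, the process with leak set \<open>L\<close> stalls with a nonempty set \<open>W\<close> of white vertices, and let \<open>N\<close>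
  be the set of blue vertices with a white neighbour. In the subgraph on \<open>W \<union> N\<close> formed by the
  edges that meet \<open>W\<close>, a vertex of \<open>W\<close> has degree at least \<open>l + 1\<close>, a vertex of \<open>N - L\<close> has degree
  at least 2 (otherwise it could force), and a vertex of \<open>N \<inter> L\<close> has degree at least 1. A
  subgraph of a unicyclic graph has at most as many edges as vertices
  (\<open>card_adjacency_le_if_unicyclic\<close>), so the degree sum is at most \<open>2 (|W| + |N|)\<close>, and
  \<open>(l - 1) |W| \<le> |N \<inter> L| \<le> l\<close> follows. As \<open>l \<ge> 3\<close>, this forces \<open>|W| = 1\<close>. But then no vertex of \<open>N\<close>
  has two white neighbours, so \<open>N \<subseteq> L\<close>, and the only white vertex has all of its at least \<open>l + 1\<close>
  neighbours among at most \<open>l\<close> leaks, which is absurd (\<open>stalled_imp_all_blue\<close>).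

  The edge bound rests on the fact that a forest has fewer edges than vertices
  (\<open>card_forest_le\<close>): deleting an edge of the unique cycle leaves a forest. Edges are counted in
  symmetric relations, where every edge contributes two pairs; subgraphs are then subsets, and
  only cycles have to be translated to arc walks.
\<close>

section \<open>Edges of forests\<close>

text \<open>
  Prepending the last vertex makes the closing edge one of the successive pairs, and the list
  becomes the vertex list of the corresponding closed arc walk.
\<close>
definition simple_cycle :: "('a \<times> 'a) set \<Rightarrow> 'a list \<Rightarrow> bool" where
  "simple_cycle R xs \<longleftrightarrow>
     3 \<le> length xs \<and> distinct xs \<and> successively (\<lambda>u v. (u, v) \<in> R) (last xs # xs)"

lemma simple_cycle_mono: "simple_cycle R xs \<Longrightarrow> R \<subseteq> R' \<Longrightarrow> simple_cycle R' xs"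
  by (auto simp: simple_cycle_def elim!: successively_mono)

text \<open>
  On a longest path, all neighbours of the first vertex lie on the path. One of them is not the
  second vertex of the path, and it closes a cycle with the initial segment that it ends.
\<close>
lemma min_degree_two_imp_simple_cycle:
  assumes "finite V" "V \<noteq> {}" "R \<subseteq> V \<times> V" "sym R" "irrefl R"
    and deg: "\<And>v. v \<in> V \<Longrightarrow> 2 \<le> card (R `` {v})"
  shows "\<exists>xs. simple_cycle R xs"
proof -
  define P where
    "P xs \<longleftrightarrow> xs \<noteq> [] \<and> distinct xs \<and> set xs \<subseteq> V \<and> successively (\<lambda>u v. (u, v) \<in> R) xs" for xs
  obtain v where "v \<in> V"
    using \<open>V \<noteq> {}\<close> by blast
  then have "P [v]"
    by (simp add: P_def)
  moreover have "length xs < Suc (card V)" if "P xs" for xs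
    using that card_mono[OF \<open>finite V\<close>, of "set xs"] by (simp add: P_def distinct_card less_Suc_eq_le)
  ultimately obtain xs where xs: "P xs" and longest: "\<And>ys. P ys \<Longrightarrow> length ys \<le> length xs"
    using ex_has_greatest_nat[of P "[v]" length "Suc (card V)"] by blast
  then obtain x ys where xs_eq: "xs = x # ys"
    by (auto simp: P_def neq_Nil_conv)
  have "x \<in> V"
    using xs xs_eq by (simp add: P_def)
  have nbr: "y \<in> set ys" if "(x, y) \<in> R" for y
  proof (rule ccontr)
    assume "y \<notin> set ys"
    moreover have "y \<noteq> x"
      using that \<open>irrefl R\<close> by (auto simp: irrefl_def)
    moreover have "y \<in> V" "(y, x) \<in> R"
      using that \<open>R \<subseteq> V \<times> V\<close> \<open>sym R\<close> by (auto dest: symD)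
    ultimately have "P (y # xs)"
      using xs by (simp add: P_def xs_eq)
    then show False
      using longest by fastforce
  qed
  have "\<not> R `` {x} \<subseteq> {hd ys}"
    using deg[OF \<open>x \<in> V\<close>] card_mono[of "{hd ys}" "R `` {x}"] by auto
  then obtain y where y: "(x, y) \<in> R" "y \<noteq> hd ys"
    by blast
  with nbr have "y \<in> set (tl ys)" "ys \<noteq> []"
    by (cases ys; force)+
  then obtain z as bs where ys: "ys = z # as @ y # bs"
    by (metis split_list list.collapse)
  have "(y, x) \<in> R"
    using y \<open>sym R\<close> by (blast dest: symD)
  moreover have "successively (\<lambda>u v. (u, v) \<in> R) ((x # z # as @ [y]) @ bs)"
    using xs by (simp add: P_def xs_eq ys)
  then have "successively (\<lambda>u v. (u, v) \<in> R) (x # z # as @ [y])"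
    unfolding successively_append_iff by blast
  ultimately have "simple_cycle R (x # z # as @ [y])"
    using xs by (auto simp: simple_cycle_def P_def xs_eq ys)
  then show ?thesis ..
qed

text \<open>
  A forest on \<open>n\<close> vertices has at most \<open>n - 1\<close> edges: without cycles there is a vertex of degree
  at most one, and removing it loses at most one edge, that is, two pairs.
\<close>
lemma card_forest_le:
  assumes "finite V" "V \<noteq> {}" "R \<subseteq> V \<times> V" "sym R" "irrefl R"
    and "\<nexists>xs. simple_cycle R xs"
  shows "card R + 2 \<le> 2 * card V"
  using assms
proof (induction "card V" arbitrary: V R)
  case 0
  then show ?case by simp
next
  case (Suc n)
  have "\<not> (\<forall>v\<in>V. 2 \<le> card (R `` {v}))"
    using min_degree_two_imp_simple_cycle[of V R] Suc.prems by blast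
  then obtain v where v: "v \<in> V" "card (R `` {v}) \<le> 1"
    by force
  define R' where "R' = R \<inter> (V - {v}) \<times> (V - {v})"
  have fin: "finite R"
    using Suc.prems(1,3) by (meson finite_SigmaI finite_subset)
  show ?case
  proof (cases "V - {v} = {}")
    case True
    with v(1) have "V = {v}" by blast
    moreover from this have "R = {}"
      using Suc.prems(3,5) by (auto simp: irrefl_def)
    ultimately show ?thesis by simp
  next
    case False
    have "R = R' \<union> Pair v ` (R `` {v}) \<union> (\<lambda>u. (u, v)) ` (R `` {v})"
    proof (rule set_eqI)
      fix z
      show "z \<in> R \<longleftrightarrow> z \<in> R' \<union> Pair v ` (R `` {v}) \<union> (\<lambda>u. (u, v)) ` (R `` {v})"
        using Suc.prems(3) symD[OF Suc.prems(4), of "fst z" "snd z"]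
          symD[OF Suc.prems(4), of "snd z" "fst z"]
        by (cases z) (auto simp: R'_def)
    qed
    then have "card R \<le> card R' + card (Pair v ` (R `` {v})) + card ((\<lambda>u. (u, v)) ` (R `` {v}))"
      by (metis (no_types, lifting) add_le_mono1 card_Un_le le_trans)
    also have "\<dots> \<le> card R' + 2"
      using v(2) card_image_le[of "R `` {v}"] finite_Image[OF fin, of "{v}"]
        card_image_le[of "R `` {v}" "Pair v"] card_image_le[of "R `` {v}" "\<lambda>u. (u, v)"] by linarith
    finally have "card R \<le> card R' + 2" .
    moreover have "card R' + 2 \<le> 2 * card (V - {v})"
    proof (rule Suc.hyps(1))
      show "n = card (V - {v})"
        using Suc.hyps(2) v(1) Suc.prems(1) by simp
      show "\<nexists>xs. simple_cycle R' xs"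
        using Suc.prems(6) simple_cycle_mono[of R' _ R] by (auto simp: R'_def)
    qed (use Suc.prems False in \<open>auto simp: R'_def sym_def irrefl_def\<close>)
    moreover have "card V = Suc (card (V - {v}))"
      using card_Suc_Diff1[OF Suc.prems(1) v(1)] by simp
    ultimately show ?thesis
      by linarith
  qed
qed

section \<open>Subgraphs of unicyclic graphs\<close>

lemma (in wf_digraph) awalk_of_vertex_list:
  assumes "R \<subseteq> arcs_ends G" "successively (\<lambda>u v. (u, v) \<in> R) (x # xs)" "x \<in> verts G"
  shows "\<exists>p. awalk x p (last (x # xs)) \<and> awalk_verts x p = x # xs \<and> arc_to_ends G ` set p \<subseteq> R"
  using assms(2,3)
proof (induction xs arbitrary: x)
  case Nil
  then show ?case
    by (intro exI[of _ "[]"]) (simp add: awalk_Nil_iff)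
next
  case (Cons y ys)
  then have "(x, y) \<in> arcs_ends G" and R: "(x, y) \<in> R"
    using assms(1) by auto
  then obtain e where e: "e \<in> arcs G" "tail G e = x" "head G e = y"
    by blast
  moreover have "y \<in> verts G"
    using e by auto
  then obtain p where "awalk y p (last (y # ys))" "awalk_verts y p = y # ys"
      "arc_to_ends G ` set p \<subseteq> R"
    using Cons.IH[of y] Cons.prems(1) by (auto simp del: last.simps)
  ultimately show ?case
    using R by (intro exI[of _ "e # p"]) (auto simp: awalk_Cons_iff arc_to_ends_def)
qed

text \<open>
  The inclusion ensures that a cycle found after the deletion of an edge avoids this edge, hence
  differs from every cycle through it.
\<close>
lemma (in wf_digraph) simple_cycle_imp_cycles:
  assumes "R \<subseteq> arcs_ends G" "simple_cycle R xs"
  shows "\<exists>C \<in> cycles G. C \<subseteq> (\<lambda>(u, v). {u, v}) ` R"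
proof -
  have xs: "3 \<le> length xs" "distinct xs" "successively (\<lambda>u v. (u, v) \<in> R) (last xs # xs)"
    using assms(2) by (auto simp: simple_cycle_def)
  then have "xs \<noteq> []" "(last xs, hd xs) \<in> arcs_ends G"
    using assms(1) by (cases xs; auto)+
  then obtain p where p: "awalk (last xs) p (last xs)" "awalk_verts (last xs) p = last xs # xs"
      "arc_to_ends G ` set p \<subseteq> R"
    using awalk_of_vertex_list[OF assms(1) xs(3)] adj_in_verts by auto
  have "length p = length xs"
    using p(2) length_awalk_verts[of "last xs" p] by simp
  then have "cycle p" "3 \<le> length p"
    using p xs unfolding cycle_def by auto
  moreover have "(\<lambda>e. {tail G e, head G e}) ` set p \<subseteq> (\<lambda>(u, v). {u, v}) ` R"
    using p(3) by (force simp: arc_to_ends_def)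
  ultimately show ?thesis
    unfolding cycles_def by blast
qed

lemma (in wf_digraph) cycles_obtain_edge:
  assumes "C \<in> cycles G"
  obtains u v where "(u, v) \<in> arcs_ends G" "{u, v} \<in> C"
proof -
  obtain p where p: "C = (\<lambda>e. {tail G e, head G e}) ` set p" "cycle p" "3 \<le> length p"
    using assms unfolding cycles_def by blast
  then have "hd p \<in> set p" "set p \<subseteq> arcs G"
    by (auto simp: cycle_def awalk_def)
  then show ?thesis
    using p(1) by (intro that[of "tail G (hd p)" "head G (hd p)"]) (auto simp: arcs_ends_conv)
qed

text \<open>
  A subgraph of a unicyclic graph has at most as many edges as vertices. Deleting from it an edge
  of the unique cycle, if present, leaves a forest, and the forest bound has one edge to spare.
\<close>
lemma (in digraph) card_adjacency_le_if_unicyclic: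
  assumes "unicyclic G"
    and "finite V" "V \<noteq> {}" "R \<subseteq> V \<times> V" "sym R" "R \<subseteq> arcs_ends G"
  shows "card R \<le> 2 * card V"
proof -
  obtain C where C: "C \<in> cycles G" and unique: "\<And>D. D \<in> cycles G \<Longrightarrow> D = C"
    using assms(1) unfolding unicyclic_def by blast
  obtain a b where ab: "{a, b} \<in> C"
    using cycles_obtain_edge[OF C] by metis
  define R' where "R' = R - {(a, b), (b, a)}"
  have "\<nexists>xs. simple_cycle R' xs"
  proof
    assume "\<exists>xs. simple_cycle R' xs"
    then obtain D where "D \<in> cycles G" "D \<subseteq> (\<lambda>(u, v). {u, v}) ` R'"
      using simple_cycle_imp_cycles[of R'] assms(6) unfolding R'_def by blast
    with unique ab show False
      by (force simp: R'_def doubleton_eq_iff)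
  qed
  moreover have "irrefl R"
    using assms(6) adj_not_same by (auto simp: irrefl_def)
  ultimately have "card R' + 2 \<le> 2 * card V"
    using assms by (intro card_forest_le) (auto simp: R'_def sym_def irrefl_def)
  moreover have "card R \<le> card R' + 2"
  proof -
    have "card {(a, b), (b, a)} \<le> 2"
      using card_length[of "[(a, b), (b, a)]"] by simp
    moreover have "card R - card {(a, b), (b, a)} \<le> card R'"
      unfolding R'_def by (rule diff_card_le_card_Diff) simp
    ultimately show ?thesis by linarith
  qed
  ultimately show ?thesis by linarith
qed

section \<open>Stalled leaky forcing processes\<close>

lemma (in digraph) out_degree_eq_card_neighbours: "out_degree G v = card (arcs_ends G `` {v})"
proof -
  have "arcs_ends G `` {v} = head G ` out_arcs G v"
    by (force simp: arcs_ends_conv)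
  moreover have "inj_on (head G) (out_arcs G v)"
    by (auto intro!: inj_onI no_multi_arcs simp: arc_to_ends_def)
  ultimately show ?thesis
    by (simp add: out_degree_def card_image)
qed

lemma (in graph) neighbour_commute: "u \<rightarrow> v \<longleftrightarrow> v \<rightarrow> u"
  using arcs_ends_symmetric[OF sym_arcs] by blast

text \<open>
  The double counting argument: the edges that meet the set of white vertices are too many for a
  subgraph of a unicyclic graph.
\<close>
lemma (in graph) stalled_imp_all_blue:
  assumes "unicyclic G" "3 \<le> l"
    and "B \<subseteq> verts G" and low: "{v \<in> verts G. out_degree G v \<le> l} \<subseteq> B"
    and "finite L" "card L \<le> l"
    and stalled: "\<And>B'. \<not> leaky_force G L B B'"
  shows "B = verts G"
proof (rule ccontr)
  assume "B \<noteq> verts G"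
  define E where "E = arcs_ends G"
  define W where "W = verts G - B"
  define N where "N = {b \<in> B. E `` {b} \<inter> W \<noteq> {}}"
  define R where "R = {(u, v) \<in> E. u \<in> W \<or> v \<in> W}"
  have "W \<noteq> {}"
    using \<open>B \<noteq> verts G\<close> assms(3) by (auto simp: W_def)
  have fin: "finite W" "finite N"
    using assms(3) finite_subset[OF _ finite_verts] by (auto simp: W_def N_def)
  have E_verts: "u \<in> verts G" "v \<in> verts G" if "(u, v) \<in> E" for u v
    using that adj_in_verts by (auto simp: E_def)
  have E_sym: "(v, u) \<in> E" if "(u, v) \<in> E" for u v
    using that neighbour_commute by (auto simp: E_def)
  have finE: "finite (E `` {v})" for v
    by (rule finite_subset[of _ "verts G"]) (auto dest: E_verts)
  have degW: "l + 1 \<le> card (E `` {w})" if "w \<in> W" for w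
    using that low by (auto simp: W_def E_def out_degree_eq_card_neighbours)
  have R_W: "R `` {w} = E `` {w}" if "w \<in> W" for w
    using that by (auto simp: R_def)
  have R_N: "R `` {b} = E `` {b} \<inter> W" if "b \<in> N" for b
    using that by (auto simp: R_def N_def W_def)
  have ge1: "1 \<le> card (R `` {b})" if "b \<in> N" for b
    using that finE[of b] by (auto simp: R_N Suc_le_eq card_gt_0_iff) (auto simp: N_def)
  have ge2: "2 \<le> card (R `` {b})" if b: "b \<in> N - L" for b
  proof (rule ccontr)
    assume "\<not> 2 \<le> card (R `` {b})"
    with ge1[of b] b have "card (R `` {b}) = 1" by simp
    then obtain w where "E `` {b} \<inter> W = {w}"
      using b R_N[of b] by (auto simp: card_1_singleton_iff)
    moreover have "E `` {b} \<inter> W = {u. b \<rightarrow>\<^bsub>G\<^esub> u \<and> u \<notin> B}"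
      by (auto simp: W_def E_def dest: adj_in_verts)
    ultimately have "leaky_force G L B (insert w B)"
      using b unfolding leaky_force_def by (auto simp: N_def)
    then show False using stalled by blast
  qed
  have R_sub: "R \<subseteq> (W \<union> N) \<times> (W \<union> N)"
  proof (rule subrelI)
    fix u v assume "(u, v) \<in> R"
    then have "(u, v) \<in> E" "(v, u) \<in> E" "u \<in> W \<or> v \<in> W"
      using E_sym by (auto simp: R_def)
    then show "(u, v) \<in> (W \<union> N) \<times> (W \<union> N)"
      using E_verts[of u v] by (auto simp: N_def W_def)
  qed
  have "finite R"
    using R_sub fin by (meson finite_SigmaI finite_UnI finite_subset)
  have "R = (SIGMA u : W \<union> N. R `` {u})"
    using R_sub by auto
  then have "card R = card (SIGMA u : W \<union> N. R `` {u})"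
    by (rule arg_cong)
  also have "\<dots> = (\<Sum>u\<in>W \<union> N. card (R `` {u}))"
    using fin \<open>finite R\<close> by (intro card_SigmaI ballI finite_UnI finite_Image)
  also have "\<dots> = (\<Sum>w\<in>W. card (R `` {w})) + (\<Sum>b\<in>N. card (R `` {b}))"
    using fin by (intro sum.union_disjoint) (auto simp: W_def N_def)
  also have "(\<Sum>b\<in>N. card (R `` {b})) = (\<Sum>b\<in>N \<inter> L. card (R `` {b})) + (\<Sum>b\<in>N - L. card (R `` {b}))"
    using fin by (subst sum.Int_Diff[of _ _ L]) auto
  finally have "card R = (\<Sum>w\<in>W. card (R `` {w})) + ((\<Sum>b\<in>N \<inter> L. card (R `` {b})) + (\<Sum>b\<in>N - L. card (R `` {b})))" .
  moreover have "(l + 1) * card W \<le> (\<Sum>w\<in>W. card (R `` {w}))"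
    using sum_bounded_below[of W "l + 1" "\<lambda>w. card (R `` {w})"] degW R_W by (simp add: mult.commute)
  moreover have "card (N \<inter> L) \<le> (\<Sum>b\<in>N \<inter> L. card (R `` {b}))"
    using sum_bounded_below[of "N \<inter> L" 1 "\<lambda>w. card (R `` {w})"] ge1 by simp
  moreover have "2 * card (N - L) \<le> (\<Sum>b\<in>N - L. card (R `` {b}))"
    using sum_bounded_below[of "N - L" 2 "\<lambda>w. card (R `` {w})"] ge2 by (simp add: mult.commute)
  moreover have "card R \<le> 2 * card (W \<union> N)"
    by (rule card_adjacency_le_if_unicyclic[OF assms(1) _ _ R_sub])
      (use fin \<open>W \<noteq> {}\<close> E_sym in \<open>auto simp: R_def E_def sym_def\<close>)
  moreover have "card (W \<union> N) = card W + card N"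
    using fin by (intro card_Un_disjoint) (auto simp: W_def N_def)
  moreover have "card N = card (N \<inter> L) + card (N - L)"
    using fin by (metis card_Int_Diff)
  ultimately have "(l + 1) * card W \<le> 2 * card W + card (N \<inter> L)"
    by linarith
  then have "(l - 1) * card W \<le> card (N \<inter> L)"
    using \<open>3 \<le> l\<close> by (cases l) auto
  also have "\<dots> \<le> l"
    using assms(5,6) card_mono[of L "N \<inter> L"] by simp
  finally have bound: "(l - 1) * card W \<le> l" .
  \<comment> \<open>Here \<open>l \<ge> 3\<close> enters: two white vertices would give \<open>2 (l - 1) \<le> l\<close>.\<close>
  have "card W < 2"
  proof (rule ccontr)
    assume "\<not> card W < 2"
    then have "(l - 1) * 2 \<le> (l - 1) * card W" by simp
    with bound \<open>3 \<le> l\<close> show False by linarith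
  qed
  moreover have "card W > 0"
    using fin \<open>W \<noteq> {}\<close> by (simp add: card_gt_0_iff)
  ultimately have "card W = 1" by linarith
  then obtain w where w: "W = {w}"
    by (auto simp: card_1_singleton_iff)
  have "N \<subseteq> L"
  proof
    fix b assume "b \<in> N"
    then have "card (R `` {b}) \<le> 1"
      using card_mono[of "{w}" "R `` {b}"] w by (auto simp: R_N)
    with ge2[of b] \<open>b \<in> N\<close> show "b \<in> L" by fastforce
  qed
  moreover have "E `` {w} \<subseteq> N"
  proof
    fix u assume "u \<in> E `` {w}"
    moreover have "u \<noteq> w"
      using \<open>u \<in> E `` {w}\<close> adj_not_same by (auto simp: E_def)
    ultimately show "u \<in> N"
      using w E_sym E_verts by (auto simp: N_def W_def)
  qed
  ultimately have "card (E `` {w}) \<le> l"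
    using assms(5,6) by (meson card_mono le_trans subset_trans)
  then show False
    using degW[of w] w by simp
qed

lemma (in wf_digraph) leaky_force_step:
  assumes "leaky_force G L B B'" "B \<subseteq> verts G"
  shows "B \<subset> B'" "B' \<subseteq> verts G"
proof -
  obtain b w where bw: "{u. b \<rightarrow>\<^bsub>G\<^esub> u \<and> u \<notin> B} = {w}" "B' = insert w B"
    using assms(1) unfolding leaky_force_def by blast
  then have "b \<rightarrow>\<^bsub>G\<^esub> w" "w \<notin> B" by auto
  then show "B \<subset> B'" "B' \<subseteq> verts G"
    using bw(2) assms(2) adj_in_verts(2) by auto
qed

lemma (in fin_digraph) leaky_force_stalls:
  assumes "S \<subseteq> verts G"
  obtains B where "(leaky_force G L)\<^sup>*\<^sup>* S B" "S \<subseteq> B" "B \<subseteq> verts G" "\<And>B'. \<not> leaky_force G L B B'"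
proof -
  have inv: "S \<subseteq> B \<and> B \<subseteq> verts G" if "(leaky_force G L)\<^sup>*\<^sup>* S B" for B
    using that by induction (use assms leaky_force_step in blast)+
  then have "card B < Suc (card (verts G))" if "(leaky_force G L)\<^sup>*\<^sup>* S B" for B
    using that card_mono[OF finite_verts] by (simp add: less_Suc_eq_le)
  then obtain B where B: "(leaky_force G L)\<^sup>*\<^sup>* S B"
    and greatest: "\<And>B'. (leaky_force G L)\<^sup>*\<^sup>* S B' \<Longrightarrow> card B' \<le> card B"
    using ex_has_greatest_nat[of "(leaky_force G L)\<^sup>*\<^sup>* S" S card "Suc (card (verts G))"] by blast
  have "\<not> leaky_force G L B B'" for B'
  proof
    assume step: "leaky_force G L B B'"
    then have "card B < card B'"
      using leaky_force_step[OF step] inv[OF B] finite_subset[OF _ finite_verts]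
      by (intro psubset_card_mono) auto
    with greatest[of B'] B step show False
      by (meson not_less rtranclp.rtrancl_into_rtrancl)
  qed
  with B inv that show ?thesis by blast
qed

section \<open>Leaky forcing sets\<close>

text \<open>
  A vertex all of whose neighbours are leaks can only be blue from the start, and \<open>l\<close> leaks
  suffice to cover the neighbourhood of a vertex of degree at most \<open>l\<close>.
\<close>
lemma (in graph) low_degree_subset_leaky_forcing_set:
  assumes "leaky_forcing_set l G S"
  shows "{v \<in> verts G. out_degree G v \<le> l} \<subseteq> S"
proof (rule subsetI, rule ccontr)
  fix v assume v: "v \<in> {v \<in> verts G. out_degree G v \<le> l}" and "v \<notin> S"
  let ?N = "arcs_ends G `` {v}"
  have "?N \<subseteq> verts G"
    by (auto dest: adj_in_verts)
  then have "card ?N \<le> min l (card (verts G))"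
    using v card_mono[OF finite_verts] by (auto simp: out_degree_eq_card_neighbours)
  \<comment> \<open>The leaks have to be padded to the prescribed number, which the neighbours need not reach.\<close>
  then obtain L where L: "?N \<subseteq> L" "L \<subseteq> verts G" "card L = min l (card (verts G))"
    using exists_subset_between[OF _ _ \<open>?N \<subseteq> verts G\<close> finite_verts] by (metis min.cobounded2)
  then have "(leaky_force G L)\<^sup>*\<^sup>* S (verts G)"
    using assms by (auto simp: leaky_forcing_set_def)
  moreover have "v \<notin> B" if "(leaky_force G L)\<^sup>*\<^sup>* S B" for B
    using that
  proof induction
    case base
    show ?case by fact
  next
    case (step B B')
    then obtain b w where bw: "b \<notin> L" "{u. b \<rightarrow>\<^bsub>G\<^esub> u \<and> u \<notin> B} = {w}" "B' = insert w B"
      unfolding leaky_force_def by blast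
    then have "b \<rightarrow>\<^bsub>G\<^esub> w" by auto
    then have "w \<noteq> v"
      using bw(1) L(1) neighbour_commute by auto
    with step bw(3) show ?case by simp
  qed
  ultimately show False
    using v by blast
qed

lemma (in graph) low_degree_leaky_forcing_set:
  assumes "unicyclic G" "3 \<le> l"
  shows "leaky_forcing_set l G {v \<in> verts G. out_degree G v \<le> l}" (is "leaky_forcing_set l G ?S")
  unfolding leaky_forcing_set_def
proof (intro conjI allI impI)
  fix L assume L: "L \<subseteq> verts G \<and> card L = min l (card (verts G))"
  obtain B where B: "(leaky_force G L)\<^sup>*\<^sup>* ?S B" "?S \<subseteq> B" "B \<subseteq> verts G"
      "\<And>B'. \<not> leaky_force G L B B'"
    using leaky_force_stalls[of ?S] by blast
  have "finite L" "card L \<le> l"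
    using L finite_subset[OF _ finite_verts] by auto
  with B assms have "B = verts G"
    by (intro stalled_imp_all_blue)
  with B(1) show "(leaky_force G L)\<^sup>*\<^sup>* ?S (verts G)"
    by simp
qed auto

theorem theorem3p9:
  fixes G :: "('a,'b) pre_digraph" and l :: nat
  assumes "graph G" and "unicyclic G" and "l \<ge> 3"
  shows "leaky_forcing_number l G = card {v \<in> verts G. out_degree G v \<le> l}"
proof -
  interpret graph G by fact
  show ?thesis
    unfolding leaky_forcing_number_def
  proof (rule Least_equality)
    show "\<exists>S. leaky_forcing_set l G S \<and> card S = card {v \<in> verts G. out_degree G v \<le> l}"
      by (intro exI[of _ "{v \<in> verts G. out_degree G v \<le> l}"] conjI refl
          low_degree_leaky_forcing_set[OF assms(2,3)])
  next
    fix k assume "\<exists>S. leaky_forcing_set l G S \<and> card S = k"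
    then obtain S where S: "leaky_forcing_set l G S" "card S = k"
      by blast
    then have "finite S"
      using finite_subset[OF _ finite_verts] by (auto simp: leaky_forcing_set_def)
    with S show "card {v \<in> verts G. out_degree G v \<le> l} \<le> k"
      using card_mono[OF _ low_degree_subset_leaky_forcing_set] by blast
  qed
qed

end
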